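(* Let $\{\pi_n\}_{n\ge 0}$ be the monic Legendre polynomials, i.e. $\pi_0(x)=1$, $\pi_1(x)=x$ and $\pi_{n+1}(x)=x\pi_n(x)-\frac{n^2}{4n^2-1}\pi_{n-1}(x)$ for $n\ge 1$. Then, as $n\to\infty$, we have $$\pi_n(x)\sim\left(\frac{x+\sqrt{x^2-1}}{2}\right)^n\left(\frac{x+\sqrt{x^2-1}}{2\sqrt{x^2-1}}\right)^{1/2}$$ for $x$ in the complex plane bounded away from $[-1,1]$.
   Context: The polynomials satisfy $\pi_n(x)=\frac{2^n n!}{(n+1)_n}P_n(x)$, where $P_n(x)={}_2F_1\left(-n,n+1;1;\frac{1-x}{2}\right)$ is the Legendre polynomial and $(a)_n=a(a+1)\cdots(a+n-1)$. The square root $\sqrt{x^2-1}$, for $x\in\mathbb{C}\setminus[-1,1]$, takes its principal value so that $\sqrt{x^2-1}\sim x$ as $x\to\infty$. The outer power $1/2$ is the principal branch. *)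

theory Defs
  imports "HOL-Analysis.Analysis" "HOL-Computational_Algebra.Polynomial"
begin

fun monic_legendre :: "nat \<Rightarrow> complex poly" where
  "monic_legendre 0 = 1"
| "monic_legendre (Suc 0) = [:0, 1:]"
| "monic_legendre (Suc (Suc n)) =
     [:0, 1:] * monic_legendre (Suc n)
     - smult (of_nat (Suc n) ^ 2 / (4 * of_nat (Suc n) ^ 2 - 1)) (monic_legendre n)"

text \<open>
  The branch of the square root of \<open>x^2 - 1\<close> on the complement of the segment \<open>[-1, 1]\<close> that
  behaves like \<open>x\<close> at infinity. The principal root \<open>csqrt (x^2 - 1)\<close> is a different function:
  it has the wrong sign in the left half-plane. The three lemmas below pin the branch down.
\<close>

definition sqrt_sq_minus_1 :: "complex \<Rightarrow> complex" where
  "sqrt_sq_minus_1 x = x * csqrt (1 - 1 / x^2)"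

lemma sqrt_sq_minus_1_power2:
  assumes "x \<noteq> 0"
  shows "sqrt_sq_minus_1 x ^ 2 = x^2 - 1"
  using assms by (simp add: sqrt_sq_minus_1_def power_mult_distrib right_diff_distrib)

lemma sqrt_sq_minus_1_at_infinity:
  "((\<lambda>x. sqrt_sq_minus_1 x / x) \<longlongrightarrow> 1) at_infinity"
proof -
  have "((\<lambda>x::complex. inverse x) \<longlongrightarrow> 0) at_infinity"
    by (rule tendsto_inverse_0)
  then have "((\<lambda>x::complex. 1 - (inverse x)^2) \<longlongrightarrow> 1 - 0^2) at_infinity"
    by (intro tendsto_intros)
  then have lim: "((\<lambda>x::complex. 1 - 1 / x^2) \<longlongrightarrow> 1) at_infinity"
    by (simp add: power_inverse inverse_eq_divide power_divide)
  have "isCont csqrt 1"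
    by (rule continuous_at_csqrt) (simp add: complex_nonpos_Reals_iff)
  from isCont_tendsto_compose[OF this lim]
  have "((\<lambda>x. csqrt (1 - 1 / x^2)) \<longlongrightarrow> 1) at_infinity" by simp
  moreover have "eventually (\<lambda>x::complex. csqrt (1 - 1 / x^2) = sqrt_sq_minus_1 x / x) at_infinity"
    unfolding eventually_at_infinity
    by (rule exI[of _ 1]) (auto simp: sqrt_sq_minus_1_def)
  ultimately show ?thesis by (rule Lim_transform_eventually)
qed

lemma sqrt_sq_minus_1_holomorphic:
  "sqrt_sq_minus_1 holomorphic_on - closed_segment (-1) 1"
proof -
  have seg: "complex_of_real t \<in> closed_segment (-1) 1" if "\<bar>t\<bar> \<le> 1" for t
  proof -
    have "complex_of_real t \<in> closed_segment (of_real (-1)) (of_real 1)"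
      unfolding of_real_closed_segment using that by (auto simp: closed_segment_eq_real_ivl)
    then show ?thesis by simp
  qed
  have nz: "x \<noteq> 0" if "x \<notin> closed_segment (-1) 1" for x :: complex
    using that seg[of 0] by auto
  have cut: "1 - 1 / x^2 \<notin> \<real>\<^sub>\<le>\<^sub>0" if x: "x \<notin> closed_segment (-1) 1" for x :: complex
  proof
    assume "1 - 1 / x^2 \<in> \<real>\<^sub>\<le>\<^sub>0"
    then obtain r where r: "r \<le> 0" "1 - 1 / x^2 = of_real r"
      by (auto elim!: nonpos_Reals_cases)
    define s where "s = 1 / (1 - r)"
    have "1 / x^2 = of_real (1 - r)"
      using r(2) by (simp add: algebra_simps)
    then have "x^2 = of_real s"
      unfolding s_def of_real_divide of_real_1 by (metis divide_divide_eq_right div_by_1 mult_1)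
    moreover have s: "0 < s" "s \<le> 1" using r(1) by (auto simp: s_def)
    ultimately have "x^2 = (of_real (sqrt s))^2"
      by (simp flip: of_real_power)
    then have "x = of_real (sqrt s) \<or> x = of_real (- sqrt s)"
      by (simp add: power2_eq_iff)
    then show False using x s seg[of "sqrt s"] seg[of "- sqrt s"] by auto
  qed
  show ?thesis
    unfolding sqrt_sq_minus_1_def
    by (intro holomorphic_intros holomorphic_on_csqrt') (auto simp: nz cut)
qed

end

theory Submission
  imports Defs
begin

text \<open>
  Put \<open>w = x + sqrt_sq_minus_1 x\<close>, so that \<open>2 * x = w + 1 / w\<close>, and \<open>u = 1 / w ^ 2\<close>. The generating
  function \<open>(1 - w * t) powr (- 1/2) * (1 - t / w) powr (- 1/2)\<close> of the Legendre polynomials shows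
  that, with \<open>a k\<close> the \<open>k\<close>-th Taylor coefficient of \<open>(1 - u) powr (- 1/2)\<close>, the monic polynomial of
  degree \<open>n\<close> equals \<open>(w / 2) ^ n\<close> times \<open>\<Sum>k\<le>n. (a k * a (n - k) / a n) * u ^ k\<close>. This exact
  formula is \<open>poly_monic_legendre_joukowsky\<close>; it is obtained here by checking that the right-hand
  side satisfies the three-term recurrence.

  The weights \<open>a k * a (n - k) / a n\<close> lie between 0 and 1 and tend to \<open>a k\<close> as \<open>n\<close> grows, because
  \<open>a\<close> is supermultiplicative and has consecutive ratios tending to 1. Dominated convergence of
  series (Tannery) therefore turns the sum into \<open>(1 - u) powr (- 1/2)\<close>, uniformly on every disc
  \<open>norm u \<le> r\<close> with \<open>r < 1\<close> (\<open>uniform_limit_legendre_sum\<close>). Since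
  \<open>1 / (1 - u) = w / (2 * sqrt_sq_minus_1 x)\<close>, this is the asserted limit.

  It remains to see that \<open>u\<close> stays in such a disc. This is \<open>infdist_joukowsky_le\<close>: the distance
  from \<open>x\<close> to the segment is at most \<open>norm w - 1\<close>, so distance at least \<open>\<delta>\<close> forces
  \<open>norm u \<le> 1 / (1 + \<delta>) ^ 2\<close>.
\<close>


section \<open>Taylor coefficients of the inverse square root\<close>

text \<open>
  The Taylor coefficients of \<open>(1 - u) powr (- 1/2)\<close>, which are also the central binomial
  coefficients \<open>2 * k choose k\<close> divided by \<open>4 ^ k\<close>.
\<close>

definition central_coeff :: "nat \<Rightarrow> real" where
  "central_coeff k = pochhammer (1/2) k / fact k"

lemma central_coeff_0 [simp]: "central_coeff 0 = 1"
  by (simp add: central_coeff_def)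

lemma central_coeff_Suc:
  "central_coeff (Suc k) = central_coeff k * ((2 * real k + 1) / (2 * real k + 2))"
  by (simp add: central_coeff_def pochhammer_Suc divide_simps) (simp add: algebra_simps)

lemma central_coeff_pos: "central_coeff k > 0"
  by (induction k) (auto simp: central_coeff_Suc intro!: mult_pos_pos divide_pos_pos)

lemma central_coeff_le_1: "central_coeff k \<le> 1"
proof (induction k)
  case (Suc k)
  then show ?case
    using central_coeff_pos[of k] unfolding central_coeff_Suc
    by (intro mult_le_one) auto
qed simp

text \<open>
  The ratio of consecutive coefficients, \<open>(2 * k + 1) / (2 * k + 2)\<close>, increases with \<open>k\<close>. Hence each
  of the \<open>k\<close> steps from \<open>central_coeff m\<close> to \<open>central_coeff (k + m)\<close> loses no more than the
  corresponding step from \<open>central_coeff 0 = 1\<close> to \<open>central_coeff k\<close>.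
\<close>

lemma central_coeff_supermultiplicative:
  "central_coeff k * central_coeff m \<le> central_coeff (k + m)"
proof (induction k)
  case (Suc k)
  have "central_coeff (Suc k) * central_coeff m
      = (central_coeff k * central_coeff m) * ((2 * real k + 1) / (2 * real k + 2))"
    by (simp add: central_coeff_Suc)
  also have "\<dots> \<le> central_coeff (k + m) * ((2 * real (k + m) + 1) / (2 * real (k + m) + 2))"
    by (intro mult_mono Suc.IH) (auto simp: divide_simps algebra_simps central_coeff_pos less_imp_le)
  finally show ?case by (simp add: central_coeff_Suc)
qed simp

lemma central_coeff_ratio_tendsto_1:
  "(\<lambda>n. central_coeff n / central_coeff (n + k)) \<longlonglongrightarrow> 1"
proof (induction k)
  case 0
  have "central_coeff n / central_coeff (n + 0) = 1" for n
    using central_coeff_pos[of n] by simp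
  then show ?case by simp
next
  case (Suc k)
  have "(\<lambda>n. 1 / (2 * real (n + k) + 1)) \<longlonglongrightarrow> 0"
  proof (rule tendsto_sandwich[OF _ _ tendsto_const LIMSEQ_inverse_real_of_nat])
    show "\<forall>\<^sub>F n in sequentially. 1 / (2 * real (n + k) + 1) \<le> inverse (real (Suc n))"
      by (intro always_eventually) (auto simp: field_simps)
  qed simp
  then have "(\<lambda>n. 1 + 1 / (2 * real (n + k) + 1)) \<longlonglongrightarrow> 1 + 0"
    by (intro tendsto_add tendsto_const)
  then have "(\<lambda>n. central_coeff n / central_coeff (n + k) * (1 + 1 / (2 * real (n + k) + 1)))
      \<longlonglongrightarrow> 1 * (1 + 0)"
    by (intro tendsto_mult Suc.IH)
  moreover have "central_coeff n / central_coeff (n + k) * (1 + 1 / (2 * real (n + k) + 1))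
      = central_coeff n / central_coeff (n + Suc k)" for n
    using central_coeff_pos[of "n + k"]
    by (simp add: central_coeff_Suc divide_simps add_pos_nonneg)
  ultimately show ?case by simp
qed

text \<open>
  The binomial series for exponent \<open>- 1/2\<close>. The sum is written with the reciprocal inside the power,
  the form in which it occurs in the asymptotic formula. Moving the reciprocal across the
  principal branch is legitimate because \<open>1 - u\<close> lies in the right half-plane.
\<close>

lemma central_coeff_sums:
  fixes u :: complex
  assumes "norm u < 1"
  shows "(\<lambda>k. of_real (central_coeff k) * u ^ k) sums (1 / (1 - u)) powr (1/2)"
proof -
  have "complex_of_real (central_coeff k) * u ^ k = ((- 1/2) gchoose k) * (- u) ^ k" for k
  proof -
    have "(- u) ^ k = (-1) ^ k * u ^ k" by (rule power_minus)
    moreover have "complex_of_real (pochhammer (1/2) k) = pochhammer (1/2) k"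
      by (simp add: pochhammer_of_real[symmetric])
    ultimately show ?thesis
      by (simp add: central_coeff_def gbinomial_pochhammer flip: power_mult_distrib)
  qed
  moreover have "(\<lambda>k. ((- 1/2) gchoose k) * (- u) ^ k) sums (1 + - u) powr (- 1/2)"
    using assms by (intro gen_binomial_complex) simp
  moreover have "(1 + - u) powr (- 1/2) = (1 / (1 - u)) powr (1/2)"
  proof -
    have "Re u < 1" using assms complex_Re_le_cmod[of u] by simp
    then have "1 - u \<notin> \<real>\<^sub>\<le>\<^sub>0" "1 - u \<noteq> 0"
      by (auto simp: complex_nonpos_Reals_iff)
    then have "Ln (1 / (1 - u)) = - Ln (1 - u)"
      by (simp add: Ln_inverse flip: inverse_eq_divide)
    then show ?thesis
      using \<open>1 - u \<noteq> 0\<close> by (simp add: powr_def)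
  qed
  ultimately show ?thesis by simp
qed


section \<open>The finite expansion of the monic Legendre polynomials\<close>

text \<open>
  The coefficient of \<open>w ^ (n - 2 * k)\<close> in the Legendre polynomial of degree \<open>n\<close> at
  \<open>(w + 1 / w) / 2\<close> is \<open>central_coeff k * central_coeff (n - k)\<close>; it is divided here by the
  coefficient of \<open>w ^ n\<close>. Setting the values beyond \<open>k = n\<close> to 0 makes the recurrence hold at the
  boundary and lets the sums below be read as infinite series.
\<close>

definition legendre_coeff :: "nat \<Rightarrow> nat \<Rightarrow> real" where
  "legendre_coeff n k =
     (if k \<le> n then central_coeff k * central_coeff (n - k) / central_coeff n else 0)"

lemma legendre_coeff_0 [simp]: "legendre_coeff n 0 = 1"
  using central_coeff_pos[of n] by (simp add: legendre_coeff_def)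

lemma legendre_coeff_self [simp]: "legendre_coeff n n = 1"
  using central_coeff_pos[of n] by (simp add: legendre_coeff_def)

lemma legendre_coeff_eq_0: "n < k \<Longrightarrow> legendre_coeff n k = 0"
  by (simp add: legendre_coeff_def)

lemma legendre_coeff_nonneg: "legendre_coeff n k \<ge> 0"
  by (simp add: legendre_coeff_def central_coeff_pos less_imp_le)

lemma legendre_coeff_le_1: "legendre_coeff n k \<le> 1"
  using central_coeff_supermultiplicative[of k "n - k"] central_coeff_pos[of n]
  by (auto simp: legendre_coeff_def)

lemma legendre_coeff_tendsto: "(\<lambda>n. legendre_coeff n k) \<longlonglongrightarrow> central_coeff k"
proof (rule LIMSEQ_offset[of _ k])
  have "(\<lambda>n. central_coeff k * (central_coeff n / central_coeff (n + k))) \<longlonglongrightarrow> central_coeff k * 1"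
    by (intro tendsto_mult tendsto_const central_coeff_ratio_tendsto_1)
  then show "(\<lambda>n. legendre_coeff (n + k) k) \<longlonglongrightarrow> central_coeff k"
    by (simp add: legendre_coeff_def)
qed

text \<open>
  The three-term recurrence compared coefficientwise. In the main case all four coefficients are
  rational multiples of \<open>legendre_coeff n k\<close>, which leaves an identity of rational functions in \<open>k\<close>
  and \<open>n - k\<close>.
\<close>

lemma legendre_coeff_recurrence:
  "legendre_coeff (Suc (Suc n)) (Suc k) = legendre_coeff (Suc n) (Suc k) + legendre_coeff (Suc n) k
     - 4 * real (Suc n) ^ 2 / (4 * real (Suc n) ^ 2 - 1) * legendre_coeff n k"
proof -
  consider "k \<le> n" | "k = Suc n" | "Suc n < k" by linarith
  then show ?thesis
  proof cases
    case 1
    then obtain m where n: "n = k + m" using le_Suc_ex by blast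
    define A where "A = central_coeff k * central_coeff m / central_coeff n"
    define p where "p = (2 * real k + 1) / (2 * real k + 2)"
    define q where "q = (2 * real m + 1) / (2 * real m + 2)"
    define s where "s = (2 * real n + 1) / (2 * real n + 2)"
    define t where "t = (2 * real n + 3) / (2 * real n + 4)"
    have t': "central_coeff (Suc (Suc n)) = central_coeff n * s * t"
      by (simp add: central_coeff_Suc s_def t_def algebra_simps)
    have 2: "legendre_coeff (Suc (Suc n)) (Suc k) = A * (p * q / (s * t))"
      by (simp add: legendre_coeff_def t' A_def)
         (simp add: n central_coeff_Suc p_def q_def Suc_diff_le mult_ac)
    have 3: "legendre_coeff (Suc n) (Suc k) = A * (p / s)"
      by (simp add: legendre_coeff_def A_def n central_coeff_Suc p_def s_def mult_ac)
    have 4: "legendre_coeff (Suc n) k = A * (q / s)"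
      by (simp add: legendre_coeff_def A_def n central_coeff_Suc q_def s_def Suc_diff_le mult_ac)
    have 5: "legendre_coeff n k = A"
      by (simp add: legendre_coeff_def A_def n)
    have 6: "4 * real (Suc n) ^ 2 / (4 * real (Suc n) ^ 2 - 1)
        = (2 * real n + 2) ^ 2 / ((2 * real n + 1) * (2 * real n + 3))"
      by (rule arg_cong2[where f = "(/)"]) (simp_all add: power2_eq_square algebra_simps)
    have "p * q / (s * t) = p / s + q / s
        - (2 * real n + 2) ^ 2 / ((2 * real n + 1) * (2 * real n + 3))"
    proof -
      define x y where "x = real k + 1" and "y = real m + 1"
      have xy: "x > 0" "y > 0" by (auto simp: x_def y_def)
      have p: "p = (2 * x - 1) / (2 * x)" and q: "q = (2 * y - 1) / (2 * y)"
        by (auto simp: p_def q_def x_def y_def)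
      have s: "s = (2 * (x + y) - 3) / (2 * (x + y) - 2)"
        and t: "t = (2 * (x + y) - 1) / (2 * (x + y))"
        and r: "(2 * real n + 2) ^ 2 / ((2 * real n + 1) * (2 * real n + 3))
           = (2 * (x + y) - 2) ^ 2 / ((2 * (x + y) - 3) * (2 * (x + y) - 1))"
        by (auto simp: s_def t_def x_def y_def n algebra_simps)
      have "2 * (x + y) - 3 \<noteq> 0" "2 * (x + y) - 2 \<noteq> 0" "2 * (x + y) - 1 \<noteq> 0" "x + y \<noteq> 0"
        by (auto simp: x_def y_def)
      then show ?thesis unfolding r unfolding p q s t using xy
        by (simp add: divide_simps) (simp add: algebra_simps power2_eq_square)
    qed
    then show ?thesis unfolding 2 3 4 5 6 by algebra
  next
    case 2
    then show ?thesis by (simp add: legendre_coeff_eq_0)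
  next
    case 3
    then show ?thesis by (simp add: legendre_coeff_eq_0)
  qed
qed

definition legendre_sum :: "nat \<Rightarrow> complex \<Rightarrow> complex" where
  "legendre_sum n u = (\<Sum>k\<le>n. of_real (legendre_coeff n k) * u ^ k)"

lemma legendre_sum_extend:
  assumes "n \<le> N"
  shows "legendre_sum n u = (\<Sum>k\<le>N. of_real (legendre_coeff n k) * u ^ k)"
  unfolding legendre_sum_def
  by (rule sum.mono_neutral_left) (use assms in \<open>auto simp: legendre_coeff_eq_0\<close>)

text \<open>
  After division by \<open>(w / 2) ^ (n + 2)\<close>, the Legendre recurrence at \<open>x = w / 2 * (1 + u)\<close> with
  \<open>u = 1 / w ^ 2\<close> takes this form: multiplication by \<open>x\<close> becomes the factor \<open>1 + u\<close>, and going back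
  two degrees costs \<open>(2 / w) ^ 2 = 4 * u\<close>.
\<close>

lemma legendre_sum_recurrence:
  "legendre_sum (Suc (Suc n)) u = (1 + u) * legendre_sum (Suc n) u
     - of_real (4 * real (Suc n) ^ 2 / (4 * real (Suc n) ^ 2 - 1)) * u * legendre_sum n u"
proof -
  define K where "K = 4 * real (Suc n) ^ 2 / (4 * real (Suc n) ^ 2 - 1)"
  have A: "legendre_sum (Suc (Suc n)) u
      = 1 + (\<Sum>k\<le>Suc n. of_real (legendre_coeff (Suc (Suc n)) (Suc k)) * u ^ Suc k)"
    unfolding legendre_sum_def by (subst sum.atMost_Suc_shift) simp
  have B: "legendre_sum (Suc n) u
      = 1 + (\<Sum>k\<le>Suc n. of_real (legendre_coeff (Suc n) (Suc k)) * u ^ Suc k)"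
    by (subst legendre_sum_extend[of _ "Suc (Suc n)"], simp, subst sum.atMost_Suc_shift) simp
  have C: "u * legendre_sum (Suc n) u = (\<Sum>k\<le>Suc n. of_real (legendre_coeff (Suc n) k) * u ^ Suc k)"
    by (simp add: legendre_sum_def sum_distrib_left mult_ac distrib_left del: sum.atMost_Suc)
  have D: "of_real K * u * legendre_sum n u
      = (\<Sum>k\<le>Suc n. of_real (K * legendre_coeff n k) * u ^ Suc k)"
    by (subst legendre_sum_extend[of _ "Suc n"])
       (simp_all add: sum_distrib_left mult_ac del: sum.atMost_Suc)
  have "(\<Sum>k\<le>Suc n. of_real (legendre_coeff (Suc (Suc n)) (Suc k)) * u ^ Suc k)
     = (\<Sum>k\<le>Suc n. of_real (legendre_coeff (Suc n) (Suc k)) * u ^ Suc k)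
       + (\<Sum>k\<le>Suc n. of_real (legendre_coeff (Suc n) k) * u ^ Suc k)
       - (\<Sum>k\<le>Suc n. of_real (K * legendre_coeff n k) * u ^ Suc k)"
    unfolding sum.distrib[symmetric] sum_subtractf[symmetric]
    by (intro sum.cong refl)
       (simp only: legendre_coeff_recurrence K_def[symmetric] of_real_add of_real_diff, simp add: algebra_simps)
  with A B C D show ?thesis
    unfolding K_def[symmetric] distrib_right by simp
qed

lemma poly_monic_legendre_joukowsky:
  assumes "w \<noteq> 0" and x: "2 * x = w + 1 / w"
  shows "poly (monic_legendre n) x = (w / 2) ^ n * legendre_sum n (1 / w ^ 2)"
proof (induction n rule: monic_legendre.induct)
  case 1
  show ?case by (simp add: legendre_sum_def)
next
  case 2
  have "x = (w + 1 / w) / 2"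
    using x by (metis nonzero_mult_div_cancel_left zero_neq_numeral)
  then show ?case using \<open>w \<noteq> 0\<close>
    by (simp add: legendre_sum_def power2_eq_square distrib_left add_divide_distrib)
next
  case (3 n)
  define K where "K = complex_of_real (real (Suc n) ^ 2 / (4 * real (Suc n) ^ 2 - 1))"
  have K: "of_nat (Suc n) ^ 2 / (4 * of_nat (Suc n) ^ 2 - 1) = K"
    "complex_of_real (4 * real (Suc n) ^ 2 / (4 * real (Suc n) ^ 2 - 1)) = 4 * K"
    by (simp_all add: K_def del: of_nat_Suc)
  have xw: "x = w / 2 * (1 + 1 / w ^ 2)"
    using x \<open>w \<noteq> 0\<close> by (simp add: field_simps power2_eq_square)
  have uw: "4 * (1 / w ^ 2) * (w / 2) ^ 2 = 1"
    using \<open>w \<noteq> 0\<close> by (simp add: field_simps)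
  have "poly (monic_legendre (Suc (Suc n))) x = x * poly (monic_legendre (Suc n)) x
      - K * poly (monic_legendre n) x"
    by (simp only: monic_legendre.simps K) simp
  also have "\<dots> = w / 2 * (1 + 1 / w ^ 2) * ((w / 2) ^ Suc n * legendre_sum (Suc n) (1 / w ^ 2))
      - K * (4 * (1 / w ^ 2) * (w / 2) ^ 2) * ((w / 2) ^ n * legendre_sum n (1 / w ^ 2))"
    unfolding 3 uw by (subst xw) simp
  also have "\<dots> = (w / 2) ^ Suc (Suc n) * legendre_sum (Suc (Suc n)) (1 / w ^ 2)"
    unfolding legendre_sum_recurrence K by (simp add: algebra_simps power2_eq_square)
  finally show ?case .
qed


section \<open>The Joukowsky parameter\<close>

text \<open>
  The two solutions of \<open>2 * x = w + 1 / w\<close> are \<open>x * (1 + s)\<close> and \<open>x * (1 - s)\<close> with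
  \<open>s = csqrt (1 - 1 / x ^ 2)\<close>, and their product is 1. As the principal root satisfies \<open>Re s \<ge> 0\<close>,
  the modulus of the first solution is at least that of the second, hence at least 1.
\<close>

lemma sqrt_sq_minus_1_joukowsky:
  assumes "x \<noteq> 0"
  defines "w \<equiv> x + sqrt_sq_minus_1 x"
  shows "w \<noteq> 0" "2 * x = w + 1 / w" "2 * sqrt_sq_minus_1 x = w - 1 / w" "1 \<le> norm w"
proof -
  define v where "v = x - sqrt_sq_minus_1 x"
  have wv: "w * v = 1"
    using sqrt_sq_minus_1_power2[OF assms(1)]
    by (simp add: w_def v_def power2_eq_square algebra_simps)
  then show w0: "w \<noteq> 0" by auto
  have v: "v = 1 / w" using wv w0 by (simp add: field_simps)
  show "2 * x = w + 1 / w" "2 * sqrt_sq_minus_1 x = w - 1 / w"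
    unfolding v[symmetric] by (simp_all add: w_def v_def)
  define s where "s = csqrt (1 - 1 / x ^ 2)"
  have "Re s \<ge> 0" unfolding s_def using Re_csqrt by blast
  then have "norm (1 - s) \<le> norm (1 + s)"
    unfolding cmod_def by (intro real_sqrt_le_mono) (simp add: power2_eq_square algebra_simps)
  then have "norm x * norm (1 - s) \<le> norm x * norm (1 + s)"
    by (intro mult_left_mono) auto
  moreover have "w = x * (1 + s)" "v = x * (1 - s)"
    by (simp_all add: w_def v_def s_def sqrt_sq_minus_1_def algebra_simps)
  ultimately have "norm v \<le> norm w" by (simp add: norm_mult)
  moreover have "norm w * norm v = 1" using wv by (metis norm_mult norm_one)
  ultimately have "1 \<le> norm w * norm w"
    by (metis mult_left_mono norm_ge_zero)
  then show "1 \<le> norm w"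
    using power2_le_imp_le[of 1 "norm w"] by (simp add: power2_eq_square)
qed

text \<open>
  Let \<open>e\<close> be the point of the unit circle in the direction of \<open>w\<close>. The map \<open>w \<mapsto> (w + 1 / w) / 2\<close>
  sends \<open>e\<close> to \<open>Re e\<close>, a point of the segment. Moving \<open>w\<close> radially from \<open>e\<close> changes \<open>w\<close> by
  \<open>norm w - 1\<close> and \<open>1 / w\<close> by at most that amount, so \<open>x\<close> is within \<open>norm w - 1\<close> of \<open>Re e\<close>.
\<close>

lemma infdist_joukowsky_le:
  fixes w x :: complex
  assumes w: "1 \<le> norm w" and x: "2 * x = w + 1 / w"
  shows "infdist x (closed_segment (-1) 1) \<le> norm w - 1"
proof -
  define e where "e = sgn w"
  have w0: "w \<noteq> 0" using w by auto
  have e: "norm e = 1" using w0 by (simp add: e_def norm_sgn)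
  have we: "w = norm w * e" using w0 by (simp add: e_def sgn_eq)
  have ie: "1 / e = cnj e" using e
    by (metis complex_div_cnj div_by_1 mult_1 norm_one of_real_1 one_power2)
  have "complex_of_real (Re e) \<in> closed_segment (of_real (-1)) (of_real 1)"
    unfolding of_real_closed_segment using abs_Re_le_cmod[of e] e
    by (auto simp: closed_segment_eq_real_ivl)
  then have "infdist x (closed_segment (-1) 1) \<le> dist x (of_real (Re e))"
    by (intro infdist_le) simp
  also have "x - of_real (Re e) = of_real ((norm w - 1) / 2) * e + of_real ((1 / norm w - 1) / 2) * cnj e"
  proof -
    have "1 / w = of_real (1 / norm w) * cnj e"
      by (subst we) (simp flip: ie)
    then have "2 * x = of_real (norm w) * e + of_real (1 / norm w) * cnj e"
      using x we by metis
    moreover have "2 * complex_of_real (Re e) = e + cnj e"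
      by (simp add: complex_add_cnj)
    moreover have "2 * complex_of_real ((norm w - 1) / 2) = of_real (norm w) - 1"
      "2 * complex_of_real ((1 / norm w - 1) / 2) = of_real (1 / norm w) - 1"
      by simp_all
    ultimately have "2 * (x - of_real (Re e))
       = 2 * (of_real ((norm w - 1) / 2) * e + of_real ((1 / norm w - 1) / 2) * cnj e)"
      by algebra
    then show ?thesis by (metis mult_left_cancel zero_neq_numeral)
  qed
  then have "dist x (of_real (Re e)) \<le> \<bar>(norm w - 1) / 2\<bar> + \<bar>(1 / norm w - 1) / 2\<bar>"
    unfolding dist_norm using norm_triangle_ineq e by (metis complex_mod_cnj mult.right_neutral norm_mult norm_of_real)
  also have "\<dots> \<le> norm w - 1"
  proof -
    have "norm w - 1 - (1 - 1 / norm w) = (norm w - 1) ^ 2 / norm w"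
      using w0 by (simp add: field_simps power2_eq_square)
    moreover have "(norm w - 1) ^ 2 / norm w \<ge> 0" by simp
    ultimately have "1 - 1 / norm w \<le> norm w - 1" by linarith
    moreover have "1 / norm w \<le> 1" using w w0 by (simp add: divide_le_eq_1)
    moreover have "\<bar>(\<rho> - 1) / 2\<bar> + \<bar>(\<sigma> - 1) / 2\<bar> \<le> \<rho> - 1"
      if "1 - \<sigma> \<le> \<rho> - 1" "\<sigma> \<le> 1" for \<rho> \<sigma> :: real
      using that by (simp add: abs_if field_simps)
    ultimately show ?thesis by blast
  qed
  finally show ?thesis .
qed


section \<open>Passage to the limit\<close>

text \<open>
  On the disc, the difference of the two sides is dominated by the single real series with terms
  \<open>\<bar>legendre_coeff n k - central_coeff k\<bar> * r ^ k\<close>, whose sum does not depend on \<open>u\<close>. Tannery's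
  theorem with majorant \<open>r ^ k\<close> sends it to 0, which yields uniformity.
\<close>

lemma uniform_limit_legendre_sum:
  assumes r: "0 \<le> r" "r < 1"
  shows "uniform_limit (cball 0 r) legendre_sum (\<lambda>u. (1 / (1 - u)) powr (1/2)) sequentially"
proof -
  define d where "d n k = \<bar>legendre_coeff n k - central_coeff k\<bar> * r ^ k" for n k
  have d_le: "norm (d n k) \<le> r ^ k" for n k
  proof -
    have "\<bar>legendre_coeff n k - central_coeff k\<bar> \<le> 1"
      using legendre_coeff_nonneg[of n k] legendre_coeff_le_1[of n k]
        central_coeff_pos[of k] central_coeff_le_1[of k] by linarith
    then show ?thesis using r by (simp add: d_def abs_mult mult_left_le_one_le)
  qed
  have d_summable: "summable (d n)" for n
    by (rule summable_comparison_test'[OF summable_geometric[of r]]) (use r d_le in auto)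
  have "(\<lambda>n. \<Sum>k. d n k) \<longlonglongrightarrow> (\<Sum>k. 0)"
  proof (rule tannerys_theorem[where M = "\<lambda>k. r ^ k", THEN conjunct2, THEN conjunct2])
    show "(\<lambda>n. d n k) \<longlonglongrightarrow> 0" for k
    proof -
      have "(\<lambda>n. d n k) \<longlonglongrightarrow> \<bar>central_coeff k - central_coeff k\<bar> * r ^ k"
        unfolding d_def by (intro tendsto_intros legendre_coeff_tendsto)
      then show ?thesis by simp
    qed
    show "summable (\<lambda>k. r ^ k)" using r by (simp add: summable_geometric)
    show "\<forall>\<^sub>F (k, n) in sequentially \<times>\<^sub>F sequentially. norm (d n k) \<le> r ^ k"
      using d_le by (intro always_eventually) auto
  qed auto
  then have lim: "(\<lambda>n. \<Sum>k. d n k) \<longlonglongrightarrow> 0" by simp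
  have bound: "norm (legendre_sum n u - (1 / (1 - u)) powr (1/2)) \<le> (\<Sum>k. d n k)"
    if u: "u \<in> cball 0 r" for n u
  proof -
    have u': "norm u \<le> r" "norm u < 1" using u r by auto
    have "(\<lambda>k. of_real (legendre_coeff n k) * u ^ k) sums legendre_sum n u"
      unfolding legendre_sum_def by (rule sums_finite) (auto simp: legendre_coeff_eq_0)
    from sums_diff[OF this central_coeff_sums[OF u'(2)]]
    have S: "(\<lambda>k. of_real (legendre_coeff n k - central_coeff k) * u ^ k)
        sums (legendre_sum n u - (1 / (1 - u)) powr (1/2))"
      by (simp add: left_diff_distrib)
    have le: "norm (of_real (legendre_coeff n k - central_coeff k) * u ^ k) \<le> d n k" for k
      unfolding d_def norm_mult norm_of_real norm_power
      by (intro mult_left_mono power_mono u') auto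
    show ?thesis
      unfolding sums_unique[OF S] by (rule norm_suminf_le[OF le d_summable])
  qed
  show ?thesis
    unfolding uniform_limit_iff
  proof (intro allI impI)
    fix e :: real assume "e > 0"
    from order_tendstoD(2)[OF lim this]
    show "\<forall>\<^sub>F n in sequentially. \<forall>u\<in>cball 0 r. dist (legendre_sum n u) ((1 / (1 - u)) powr (1/2)) < e"
      by eventually_elim (unfold dist_norm, blast intro: order_le_less_trans[OF bound])
  qed
qed


theorem theorem2p1:
  fixes \<delta> :: real
  assumes "\<delta> > 0"
  shows "uniform_limit {x :: complex. infdist x (closed_segment (-1) 1) \<ge> \<delta>}
           (\<lambda>n x. poly (monic_legendre n) x /
              (((x + sqrt_sq_minus_1 x) / 2) ^ n
               * ((x + sqrt_sq_minus_1 x) / (2 * sqrt_sq_minus_1 x)) powr (1/2)))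
           (\<lambda>x. 1) sequentially"
proof -
  define r where "r = 1 / (1 + \<delta>) ^ 2"
  have r: "0 \<le> r" "r < 1" using assms by (auto simp: r_def one_less_power)
  define G where "G u = (1 / (1 - u)) powr (1/2)" for u :: complex
  \<comment> \<open>the quotient depends on \<open>x\<close> only through \<open>u = 1 / w ^ 2\<close>, which ranges over a fixed disc\<close>
  have key: "\<exists>u\<in>cball 0 r. \<forall>n. poly (monic_legendre n) x /
              (((x + sqrt_sq_minus_1 x) / 2) ^ n
               * ((x + sqrt_sq_minus_1 x) / (2 * sqrt_sq_minus_1 x)) powr (1/2))
             = legendre_sum n u / G u"
    if x: "infdist x (closed_segment (-1) 1) \<ge> \<delta>" for x
  proof -
    have "0 \<in> closed_segment (-1) (1 :: complex)"
      by (auto simp: closed_segment_def intro!: exI[of _ "1/2"])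
    then have "x \<noteq> 0" using x assms by auto
    define w where "w = x + sqrt_sq_minus_1 x"
    note w = sqrt_sq_minus_1_joukowsky[OF \<open>x \<noteq> 0\<close>, folded w_def]
    define u where "u = 1 / w ^ 2"
    have "1 + \<delta> \<le> norm w" using infdist_joukowsky_le[OF w(4,2)] x by simp
    then have "norm u \<le> r"
      using assms by (auto simp: u_def r_def norm_divide norm_power intro!: divide_left_mono power_mono mult_pos_pos)
    moreover have "w / (2 * sqrt_sq_minus_1 x) = 1 / (1 - u)"
    proof -
      have "w - 1 / w = w * (1 - u)" using w(1) by (simp add: u_def field_simps power2_eq_square)
      then show ?thesis unfolding w(3) using w(1) by simp
    qed
    ultimately show ?thesis
      using w(1) poly_monic_legendre_joukowsky[OF w(1,2)]
      by (intro bexI[of _ u]) (auto simp: G_def simp flip: w_def u_def)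
  qed
  \<comment> \<open>dividing by \<open>G\<close> preserves uniform convergence because \<open>norm (G u) ^ 2 = 1 / norm (1 - u)\<close> is bounded below\<close>
  have G: "norm (G u) \<ge> 1 / 2" if "u \<in> cball 0 r" for u
  proof -
    have "norm u < 1" using that r by auto
    then have u: "u \<noteq> 1" "norm (1 - u) \<le> 4"
      using norm_triangle_ineq4[of 1 u] by auto
    have "norm (G u) ^ 2 = norm (G u ^ 2)" by (simp add: norm_power)
    also have "G u ^ 2 = 1 / (1 - u)"
      using u by (simp add: G_def power2_eq_square flip: powr_add)
    also have "norm \<dots> \<ge> (1 / 2) ^ 2"
      using u by (simp add: norm_divide field_simps)
    finally show ?thesis by (rule power2_le_imp_le) simp
  qed
  show ?thesis
    unfolding uniform_limit_iff
  proof (intro allI impI)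
    fix e :: real assume "e > 0"
    then have "\<forall>\<^sub>F n in sequentially. \<forall>u\<in>cball 0 r. dist (legendre_sum n u) (G u) < e / 2"
      using uniform_limit_legendre_sum[OF r] unfolding uniform_limit_iff G_def by (meson half_gt_zero)
    then show "\<forall>\<^sub>F n in sequentially. \<forall>x\<in>{x. infdist x (closed_segment (-1) 1) \<ge> \<delta>}.
        dist (poly (monic_legendre n) x /
              (((x + sqrt_sq_minus_1 x) / 2) ^ n
               * ((x + sqrt_sq_minus_1 x) / (2 * sqrt_sq_minus_1 x)) powr (1/2))) 1 < e"
    proof eventually_elim
      case (elim n)
      have "dist (legendre_sum n u / G u) 1 < e" if u: "u \<in> cball 0 r" for u
      proof -
        have G0: "norm (G u) > 0" using G[OF u] by linarith
        then have "dist (legendre_sum n u / G u) 1 = dist (legendre_sum n u) (G u) / norm (G u)"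
          by (simp add: dist_norm diff_divide_distrib flip: norm_divide)
        also have "\<dots> < (e / 2) / norm (G u)"
          using elim u G0 by (intro divide_strict_right_mono) auto
        also have "\<dots> \<le> e"
          using G[OF u] G0 \<open>e > 0\<close> by (simp add: field_simps)
        finally show ?thesis .
      qed
      then show ?case using key by fastforce
    qed
  qed
qed

end
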